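(* Let $0<\alpha\leq 1$, $s\leq s_\alpha$, and $\nu,\delta>0$. Then the estimate $$\|\partial_x(uv)\|_{X^{-1/2+\delta,s}_\alpha}\lesssim T^\nu\,\|u\|_{X^{1/2,s}_\alpha}\|v\|_{X^{1/2,s}_\alpha}$$ fails: there is no constant $C$ such that it holds for all $u,v\in X^{1/2,s}_\alpha$ with compact support (in time) in $[-T,T]$; that is, for any $C>0$ there exist such $u,v$ with $\|\partial_x(uv)\|_{X^{-1/2+\delta,s}_\alpha}> C\,T^\nu\|u\|_{X^{1/2,s}_\alpha}\|v\|_{X^{1/2,s}_\alpha}$.
   Context: For $0<\alpha\le 1$ set $s_\alpha=-3/4$ if $0<\alpha\leq 1/2$ and $s_\alpha=-\frac{3}{5-2\alpha}$ if $1/2<\alpha\leq 1$. For a function $u(t,x)$ on $\mathbb{R}^2$, $\widehat{u}(\tau,\xi)$ denotes its space-time Fourier transform ($\tau$ dual to $t$, $\xi$ dual to $x$), $\langle\cdot\rangle=(1+|\cdot|^2)^{1/2}$, and for $b,s\in\mathbb{R}$ the space $X^{b,s}_\alpha$ is defined by the norm $$\|u\|_{X^{b,s}_\alpha}=\big\|\langle i(\tau-\xi^3)+|\xi|^{2\alpha}\rangle^b\langle\xi\rangle^s\widehat{u}(\tau,\xi)\big\|_{L^2(\mathbb{R}^2)}.$$ *)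

theory Defs
  imports "HOL-Analysis.Analysis"
begin

definition s_alpha :: "real \<Rightarrow> real" where
  "s_alpha \<alpha> = (if \<alpha> \<le> 1/2 then -3/4 else - 3 / (5 - 2*\<alpha>))"

definition jbr :: "complex \<Rightarrow> real" where
  "jbr z = sqrt (1 + (cmod z)\<^sup>2)"

definition FT :: "(real \<times> real \<Rightarrow> complex) \<Rightarrow> real \<times> real \<Rightarrow> complex" where
  "FT u = (\<lambda>(\<tau>, \<xi>). LINT p|lborel.
      exp (- \<i> * complex_of_real (fst p * \<tau> + snd p * \<xi>)) * u p)"

definition Xweight :: "real \<Rightarrow> real \<Rightarrow> real \<Rightarrow> real \<times> real \<Rightarrow> real" where
  "Xweight \<alpha> b s = (\<lambda>(\<tau>, \<xi>).
      jbr (\<i> * complex_of_real (\<tau> - \<xi>^3) + complex_of_real (\<bar>\<xi>\<bar> powr (2*\<alpha>))) powr b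
      * jbr (complex_of_real \<xi>) powr s)"

definition Xnorm_hat :: "real \<Rightarrow> real \<Rightarrow> real \<Rightarrow> (real \<times> real \<Rightarrow> complex) \<Rightarrow> ennreal" where
  "Xnorm_hat \<alpha> b s f =
     (let I = (\<integral>\<^sup>+ p. ennreal ((Xweight \<alpha> b s p * cmod (f p))\<^sup>2) \<partial>lborel)
      in if I = \<infinity> then \<infinity> else ennreal (sqrt (enn2real I)))"

definition Xnorm :: "real \<Rightarrow> real \<Rightarrow> real \<Rightarrow> (real \<times> real \<Rightarrow> complex) \<Rightarrow> ennreal" where
  "Xnorm \<alpha> b s u = Xnorm_hat \<alpha> b s (FT u)"

text \<open>Norm of the x-derivative: the Fourier transform of d/dx w is i xi w^.\<close>
definition Xnorm_dx :: "real \<Rightarrow> real \<Rightarrow> real \<Rightarrow> (real \<times> real \<Rightarrow> complex) \<Rightarrow> ennreal" where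
  "Xnorm_dx \<alpha> b s w = Xnorm_hat \<alpha> b s (\<lambda>(\<tau>, \<xi>). \<i> * complex_of_real \<xi> * FT w (\<tau>, \<xi>))"

text \<open>Admissible test functions: L^1 \<inter> L^2 on R^2 (so the Fourier transform
  is given by the Lebesgue integral and products uv are integrable).\<close>
definition admissible :: "(real \<times> real \<Rightarrow> complex) \<Rightarrow> bool" where
  "admissible u \<longleftrightarrow> integrable lborel u \<and> integrable lborel (\<lambda>p. (cmod (u p))\<^sup>2)"

end

(* Take wave packets u, v at the frequencies N and -N of the curve tau = xi^3,
   moving with the common group velocity 3 N^2, with width
   gamma = N^(a - 1/2) in xi and L = N^(2a) in tau, where a = max(alpha, 1/2).
   Then N gamma^2 = L, so the curvature of tau = xi^3 and the dissipation are both
   at most of the order L of the modulation. The product uv is again an explicit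
   packet, at frequency zero, but its frequencies (tau, xi) = (3 N^2 xi + O(L), xi) with
   |xi| ~ gamma are at distance ~ N^2 gamma from the curve. The squared ratio of the two
   sides is of order N^e with e = -3 - s (5 - 2a) + delta (2a + 3), and s <= s_alpha says
   precisely that s (5 - 2a) <= -3. The time support has length ~ 1/L, so T plays no role. *)
theory Submission
  imports Defs "HOL-Probability.Characteristic_Functions" "HOL-Probability.Sinc_Integral"
begin

section \<open>Fourier transforms of moving wave packets\<close>

text \<open>Indicator functions in Fourier variables would be the simplest choice for such a power
  count, but they are incompatible with compact support in time. The packets are therefore written
  in physical space, and their profiles must make the input norms finite. After squaring, the weight
  with b = 1/2 grows linearly in the rescaled modulation \<sigma>. A sharp time cutoff has a
  transform of size 1/|\<sigma>| and leaves a logarithmically divergent integral; a continuous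
  cutoff gives decay of order 1/\<sigma>^2, which is enough. In space the weight costs a power of
  the rescaled frequency \<eta> that grows with -s, and a Gaussian absorbs every power. The
  transform of uv would in general be a convolution. Since the two envelopes travel together, they
  multiply pointwise and no convolution has to be estimated. At s = \<open>s_alpha \<alpha>\<close>
  the powers of N balance exactly, and only \<delta> makes the ratio of the two sides grow.\<close>

definition FT1 :: "(real \<Rightarrow> real) \<Rightarrow> real \<Rightarrow> complex" where
  "FT1 f y = (LINT x|lborel. exp (- \<i> * complex_of_real (x * y)) * complex_of_real (f x))"

lemma FT1_measurable [measurable]:
  assumes "f \<in> borel_measurable borel"
  shows "FT1 f \<in> borel_measurable borel"
  using assms unfolding FT1_def [abs_def] by measurable

lemma FT1_affine:
  assumes "\<gamma> > 0"
  shows "(LINT x|lborel. exp (- \<i> * complex_of_real (x * y)) * complex_of_real (f (\<gamma> * (x + d))))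
    = exp (\<i> * complex_of_real (d * y)) / \<gamma> * FT1 f (y / \<gamma>)"
proof -
  have "(LINT x|lborel. exp (- \<i> * complex_of_real (x * y)) * complex_of_real (f (\<gamma> * (x + d))))
      = \<bar>1/\<gamma>\<bar> *\<^sub>R (LINT x|lborel. exp (- \<i> * complex_of_real ((- d + 1/\<gamma> * x) * y))
          * complex_of_real (f (\<gamma> * ((- d + 1/\<gamma> * x) + d))))"
    using assms by (intro lborel_integral_real_affine) auto
  also have "\<dots> = (1/\<gamma>) *\<^sub>R (LINT x|lborel. exp (\<i> * complex_of_real (d * y)) *
      (exp (- \<i> * complex_of_real (x * (y / \<gamma>))) * complex_of_real (f x)))"
  proof -
    have "exp (- \<i> * complex_of_real ((- d + 1/\<gamma> * x) * y))
        = exp (\<i> * complex_of_real (d * y)) * exp (- \<i> * complex_of_real (x * (y / \<gamma>)))" for x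
      by (simp add: exp_add [symmetric] algebra_simps)
    then show ?thesis
      using assms by (simp add: mult.assoc)
  qed
  finally show ?thesis
    by (simp add: FT1_def scaleR_conv_of_real)
qed

text \<open>The envelope depends on x + c t because a carrier exp (i (\<tau> t + \<xi> x)) on the
  curve \<tau> = \<xi>^3 has velocity -3 \<xi>^2. On the Fourier side the motion is a shear along
  the line \<tau> - \<omega> = c (\<xi> - k), which for \<omega> = n^3, k = n, c = 3 n^2 is the
  tangent of the curve at n.\<close>

definition packet ::
    "real \<Rightarrow> real \<Rightarrow> real \<Rightarrow> real \<Rightarrow> real \<Rightarrow> (real \<Rightarrow> real) \<Rightarrow> (real \<Rightarrow> real) \<Rightarrow> real \<times> real \<Rightarrow> complex"
  where "packet L \<gamma> \<omega> k c a g = (\<lambda>(t, x). complex_of_real (a (L * t))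
    * exp (\<i> * complex_of_real (\<omega> * t + k * x)) * complex_of_real (g (\<gamma> * (x + c * t))))"

lemma packet_mult:
  "packet L \<gamma> \<omega> k c a g p * packet L \<gamma> \<omega>' k' c a' g' p
    = packet L \<gamma> (\<omega> + \<omega>') (k + k') c (\<lambda>t. a t * a' t) (\<lambda>x. g x * g' x) p"
  by (cases p) (simp add: packet_def exp_add [symmetric] algebra_simps)

lemma cmod_packet: "cmod (packet L \<gamma> \<omega> k c a g (t, x)) = \<bar>a (L * t)\<bar> * \<bar>g (\<gamma> * (x + c * t))\<bar>"
  by (simp add: packet_def norm_mult del: of_real_add of_real_mult)

text \<open>For fixed t the envelope is a translate of one function of x, so its L^1 norm in x does
  not depend on t, and Fubini leaves the integral of |a (L t)|.\<close>

lemma packet_integrable: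
  assumes a: "integrable lborel a" and g: "integrable lborel g" and "L > 0" "\<gamma> > 0"
  shows "integrable lborel (packet L \<gamma> \<omega> k c a g)"
proof -
  have [measurable]: "a \<in> borel_measurable borel" "g \<in> borel_measurable borel"
    using a g by auto
  have g': "integrable lborel (\<lambda>x. g (\<gamma> * (x + d)))" for d
    using lborel_integrable_real_affine [OF g, of \<gamma> "\<gamma> * d"] \<open>\<gamma> > 0\<close> by (simp add: algebra_simps)
  have g_shift: "(\<integral>x. \<bar>g (\<gamma> * (x + d))\<bar> \<partial>lborel) = (\<integral>x. \<bar>g (\<gamma> * x)\<bar> \<partial>lborel)" for d
    using lborel_integral_real_affine [of 1 "\<lambda>x. \<bar>g (\<gamma> * x)\<bar>" d] by (simp add: add.commute)
  have meas: "packet L \<gamma> \<omega> k c a g \<in> borel_measurable (lborel \<Otimes>\<^sub>M lborel)"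
    unfolding packet_def by measurable
  have "integrable (lborel \<Otimes>\<^sub>M lborel) (packet L \<gamma> \<omega> k c a g)"
  proof (rule lborel_pair.Fubini_integrable [OF meas])
    have "integrable lborel (\<lambda>t. \<bar>a (L * t)\<bar> * (\<integral>x. \<bar>g (\<gamma> * x)\<bar> \<partial>lborel))"
      using lborel_integrable_real_affine [OF a, of L 0] \<open>L > 0\<close> by auto
    then show "integrable lborel (\<lambda>t. \<integral>x. norm (packet L \<gamma> \<omega> k c a g (t, x)) \<partial>lborel)"
      by (simp add: cmod_packet g_shift)
    have "integrable lborel (\<lambda>x. packet L \<gamma> \<omega> k c a g (t, x))" for t
    proof (rule Bochner_Integration.integrable_bound)
      show "integrable lborel (\<lambda>x. \<bar>a (L * t)\<bar> * g (\<gamma> * (x + c * t)))"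
        using g' by auto
      show "(\<lambda>x. packet L \<gamma> \<omega> k c a g (t, x)) \<in> borel_measurable lborel"
        unfolding packet_def prod.case by measurable
    qed (simp add: cmod_packet abs_mult)
    then show "AE t in lborel. integrable lborel (\<lambda>x. packet L \<gamma> \<omega> k c a g (t, x))"
      by simp
  qed
  then show ?thesis
    by (simp add: lborel_prod)
qed

lemma packet_admissible:
  assumes "integrable lborel a" "integrable lborel g"
    "integrable lborel (\<lambda>t. (a t)\<^sup>2)" "integrable lborel (\<lambda>x. (g x)\<^sup>2)" "L > 0" "\<gamma> > 0"
  shows "admissible (packet L \<gamma> \<omega> k c a g)"
proof -
  \<comment> \<open>Square integrability reduces to integrability: the squared modulus is the
    modulus of the packet with squared profiles.\<close>
  have "(\<lambda>p. (cmod (packet L \<gamma> \<omega> k c a g p))\<^sup>2)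
      = (\<lambda>p. cmod (packet L \<gamma> \<omega> k c (\<lambda>t. (a t)\<^sup>2) (\<lambda>x. (g x)\<^sup>2) p))"
    by (auto simp: cmod_packet power_mult_distrib)
  then show ?thesis
    using assms by (simp add: admissible_def packet_integrable integrable_norm)
qed

text \<open>The x-integral at time t is the transform of a profile shifted by c t. The phase exp (i
  c t (\<xi> - k)) of this shift joins the oscillation in time and replaces \<tau> - \<omega> by
  \<tau> - \<omega> - c (\<xi> - k), so the two variables separate.\<close>

lemma FT_packet:
  assumes a: "integrable lborel a" and g: "integrable lborel g" and "L > 0" "\<gamma> > 0"
  shows "FT (packet L \<gamma> \<omega> k c a g) (\<tau>, \<xi>)
    = FT1 a ((\<tau> - \<omega> - c * (\<xi> - k)) / L) * FT1 g ((\<xi> - k) / \<gamma>) / (L * \<gamma>)"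
proof -
  let ?E = "\<lambda>p. exp (- \<i> * complex_of_real (fst p * \<tau> + snd p * \<xi>)) * packet L \<gamma> \<omega> k c a g p"
  have int: "integrable (lborel \<Otimes>\<^sub>M lborel) ?E"
  proof (rule Bochner_Integration.integrable_bound)
    have "integrable (lborel \<Otimes>\<^sub>M lborel) (packet L \<gamma> \<omega> k c a g)"
      using packet_integrable [OF assms] by (simp add: lborel_prod)
    then show "integrable (lborel \<Otimes>\<^sub>M lborel) (packet L \<gamma> \<omega> k c a g)"
      and "?E \<in> borel_measurable (lborel \<Otimes>\<^sub>M lborel)"
      by (auto dest!: borel_measurable_integrable)
    show "AE p in lborel \<Otimes>\<^sub>M lborel. norm (?E p) \<le> norm (packet L \<gamma> \<omega> k c a g p)"
      by (simp add: norm_mult del: of_real_add of_real_mult)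
  qed
  \<comment> \<open>The form \<open>L * (t + 0)\<close> lets \<open>FT1_affine\<close> with shift 0
    evaluate the remaining integral over t.\<close>
  have inner: "(LINT x|lborel. ?E (t, x)) = exp (- \<i> * complex_of_real (t * (\<tau> - \<omega> - c * (\<xi> - k))))
      * complex_of_real (a (L * (t + 0))) * (FT1 g ((\<xi> - k) / \<gamma>) / \<gamma>)" for t
  proof -
    have "(LINT x|lborel. ?E (t, x)) = (LINT x|lborel. exp (- \<i> * complex_of_real (t * (\<tau> - \<omega>)))
        * complex_of_real (a (L * t)) * (exp (- \<i> * complex_of_real (x * (\<xi> - k)))
        * complex_of_real (g (\<gamma> * (x + c * t)))))"
    proof (intro Bochner_Integration.integral_cong refl)
      fix x
      have "exp (- \<i> * complex_of_real (t * \<tau> + x * \<xi>)) * exp (\<i> * complex_of_real (\<omega> * t + k * x))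
          = exp (- \<i> * complex_of_real (t * (\<tau> - \<omega>))) * exp (- \<i> * complex_of_real (x * (\<xi> - k)))"
        by (simp add: exp_add [symmetric] algebra_simps)
      then have "(exp (- \<i> * complex_of_real (t * \<tau> + x * \<xi>)) * exp (\<i> * complex_of_real (\<omega> * t + k * x)))
          * (complex_of_real (a (L * t)) * complex_of_real (g (\<gamma> * (x + c * t))))
          = (exp (- \<i> * complex_of_real (t * (\<tau> - \<omega>))) * exp (- \<i> * complex_of_real (x * (\<xi> - k))))
          * (complex_of_real (a (L * t)) * complex_of_real (g (\<gamma> * (x + c * t))))"
        by (rule arg_cong)
      then show "?E (t, x) = exp (- \<i> * complex_of_real (t * (\<tau> - \<omega>)))
        * complex_of_real (a (L * t)) * (exp (- \<i> * complex_of_real (x * (\<xi> - k)))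
        * complex_of_real (g (\<gamma> * (x + c * t))))"
        unfolding packet_def fst_conv snd_conv prod.case by (simp only: mult_ac)
    qed
    also have "\<dots> = exp (- \<i> * complex_of_real (t * (\<tau> - \<omega>))) * complex_of_real (a (L * t))
        * (exp (\<i> * complex_of_real (c * t * (\<xi> - k))) / \<gamma> * FT1 g ((\<xi> - k) / \<gamma>))"
      unfolding integral_mult_right_zero FT1_affine [OF \<open>\<gamma> > 0\<close>] by simp
    also have "\<dots> = (exp (- \<i> * complex_of_real (t * (\<tau> - \<omega>))) * exp (\<i> * complex_of_real (c * t * (\<xi> - k))))
        * complex_of_real (a (L * t)) * (FT1 g ((\<xi> - k) / \<gamma>) / \<gamma>)"
      by simp
    also have "exp (- \<i> * complex_of_real (t * (\<tau> - \<omega>))) * exp (\<i> * complex_of_real (c * t * (\<xi> - k)))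
        = exp (- \<i> * complex_of_real (t * (\<tau> - \<omega> - c * (\<xi> - k))))"
      by (simp add: exp_add [symmetric] algebra_simps)
    finally show ?thesis by simp
  qed
  have "FT (packet L \<gamma> \<omega> k c a g) (\<tau>, \<xi>) = (LINT p|(lborel \<Otimes>\<^sub>M lborel). ?E p)"
    by (simp add: FT_def lborel_prod)
  also have "\<dots> = (LINT t|lborel. LINT x|lborel. ?E (t, x))"
    by (rule lborel_pair.integral_fst' [OF int, symmetric])
  also have "\<dots> = FT1 a ((\<tau> - \<omega> - c * (\<xi> - k)) / L) / L * (FT1 g ((\<xi> - k) / \<gamma>) / \<gamma>)"
    unfolding inner integral_mult_left_zero FT1_affine [OF \<open>L > 0\<close>] by simp
  finally show ?thesis by simp
qed

text \<open>These are the coordinates in which \<open>FT_packet\<close> is a function of \<sigma>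
  times a function of \<eta>. With \<xi> as the outer variable the shear is only a translation of
  \<tau>, so two one-dimensional affine substitutions suffice.\<close>

lemma nn_integral_lborel_packet_coords:
  fixes f :: "real \<times> real \<Rightarrow> ennreal"
  assumes [measurable]: "f \<in> borel_measurable borel" and "L > 0" "\<gamma> > 0"
  shows "(\<integral>\<^sup>+p. f p \<partial>lborel)
    = ennreal (L * \<gamma>) * (\<integral>\<^sup>+\<eta>. \<integral>\<^sup>+\<sigma>. f (\<omega> + c * (\<gamma> * \<eta>) + L * \<sigma>, k + \<gamma> * \<eta>) \<partial>lborel \<partial>lborel)"
proof -
  have f2: "f \<in> borel_measurable (lborel \<Otimes>\<^sub>M lborel)"
    by (simp add: lborel_prod)
  then have [measurable]: "f \<in> borel_measurable (borel \<Otimes>\<^sub>M borel)"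
    by (simp add: borel_prod)
  have "(\<integral>\<^sup>+p. f p \<partial>lborel) = (\<integral>\<^sup>+\<xi>. \<integral>\<^sup>+\<tau>. f (\<tau>, \<xi>) \<partial>lborel \<partial>lborel)"
    using lborel_pair.nn_integral_snd [OF f2] by (simp add: lborel_prod)
  also have "\<dots> = ennreal \<bar>\<gamma>\<bar> * (\<integral>\<^sup>+\<eta>. \<integral>\<^sup>+\<tau>. f (\<tau>, k + \<gamma> * \<eta>) \<partial>lborel \<partial>lborel)"
    using \<open>\<gamma> > 0\<close> by (intro nn_integral_real_affine) auto
  also have "(\<lambda>\<eta>. \<integral>\<^sup>+\<tau>. f (\<tau>, k + \<gamma> * \<eta>) \<partial>lborel)
      = (\<lambda>\<eta>. ennreal \<bar>L\<bar> * (\<integral>\<^sup>+\<sigma>. f (\<omega> + c * (\<gamma> * \<eta>) + L * \<sigma>, k + \<gamma> * \<eta>) \<partial>lborel))"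
    using \<open>L > 0\<close> by (intro ext nn_integral_real_affine) auto
  also have "ennreal \<bar>\<gamma>\<bar> * (\<integral>\<^sup>+\<eta>. ennreal \<bar>L\<bar> *
        (\<integral>\<^sup>+\<sigma>. f (\<omega> + c * (\<gamma> * \<eta>) + L * \<sigma>, k + \<gamma> * \<eta>) \<partial>lborel) \<partial>lborel)
      = ennreal (L * \<gamma>) * (\<integral>\<^sup>+\<eta>. \<integral>\<^sup>+\<sigma>. f (\<omega> + c * (\<gamma> * \<eta>) + L * \<sigma>, k + \<gamma> * \<eta>) \<partial>lborel \<partial>lborel)"
    using assms(2,3)
    by (subst nn_integral_cmult) (simp_all add: ennreal_mult mult_ac)
  finally show ?thesis .
qed

lemma cmod_FT1_le: "cmod (FT1 f y) \<le> (LINT x|lborel. \<bar>f x\<bar>)"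
proof -
  have "cmod (FT1 f y) \<le> (LINT x|lborel. cmod (exp (- \<i> * complex_of_real (x * y)) * complex_of_real (f x)))"
    unfolding FT1_def by (rule integral_norm_bound)
  then show ?thesis
    by (simp add: norm_mult del: of_real_mult)
qed

section \<open>Profiles in time and space\<close>

definition bump :: "real \<Rightarrow> real" where
  "bump t = indicator {-1..1} t * (1 - t\<^sup>2)"

lemma bump_measurable [measurable]: "bump \<in> borel_measurable borel"
  unfolding bump_def [abs_def] by measurable

lemma bump_bounds: "0 \<le> bump t" "bump t \<le> 1"
  by (auto simp: bump_def indicator_def abs_square_le_1 abs_le_iff)

lemma bump_integrable: "integrable lborel bump"
proof (rule Bochner_Integration.integrable_bound)
  show "integrable lborel (indicator {-1..1::real} :: real \<Rightarrow> real)"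
    by simp
qed (use bump_bounds in \<open>auto simp: indicator_def bump_def abs_square_le_1 abs_le_iff\<close>)

lemma bump_square_integrable: "integrable lborel (\<lambda>t. bump t * bump t)"
  using bump_integrable bump_bounds
  by (rule_tac Bochner_Integration.integrable_bound[OF bump_integrable]) (auto simp: mult_left_le)

text \<open>A polynomial times an exponential has an explicit antiderivative. Its 1/\<sigma> term
  carries the factor 1 - t^2 and vanishes at both endpoints, so the leading order is
  1/\<sigma>^2.\<close>

lemma FT1_bump_eq:
  assumes "\<sigma> \<noteq> 0"
  shows "FT1 bump \<sigma> =
      exp (- \<i> * complex_of_real \<sigma>) * (- 2 / \<sigma>\<^sup>2 + 2 * \<i> / \<sigma>^3)
    - exp (\<i> * complex_of_real \<sigma>) * (2 / \<sigma>\<^sup>2 + 2 * \<i> / \<sigma>^3)"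
proof -
  define F where "F = (\<lambda>t::complex. exp (- \<i> * t * \<sigma>)
    * (\<i> / \<sigma> * (1 - t\<^sup>2) - 2 / \<sigma>\<^sup>2 * t + 2 * \<i> / \<sigma>^3))"
  have "FT1 bump \<sigma> = (LINT t|lborel. indicator {-1..1} t *\<^sub>R
      (exp (- \<i> * complex_of_real (t * \<sigma>)) * complex_of_real (1 - t\<^sup>2)))"
    unfolding FT1_def by (intro Bochner_Integration.integral_cong) (auto simp: bump_def indicator_def)
  also have "\<dots> = F (of_real 1) - F (of_real (-1))"
  proof (rule integral_FTC_atLeastAtMost)
    fix t :: real
    have "(F has_field_derivative exp (- \<i> * complex_of_real (t * \<sigma>)) * complex_of_real (1 - t\<^sup>2))
        (at (complex_of_real t))"
      unfolding F_def using assms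
      by (auto intro!: derivative_eq_intros simp: field_simps power2_eq_square power3_eq_cube)
    then show "((\<lambda>t. F (complex_of_real t)) has_vector_derivative
        exp (- \<i> * complex_of_real (t * \<sigma>)) * complex_of_real (1 - t\<^sup>2)) (at t within {-1..1})"
      using has_vector_derivative_real_field has_vector_derivative_at_within by blast
  qed (auto intro!: continuous_intros)
  finally show ?thesis
    by (simp add: F_def)
qed

text \<open>For |\<sigma>| \<le> 1 the L^1 bound 2 is enough. Otherwise the explicit formula gives
  8/\<sigma>^2, and 1 \<le> \<sigma>^2 turns this into 16/(1 + \<sigma>^2).\<close>

lemma cmod_FT1_bump_le: "cmod (FT1 bump \<sigma>) \<le> 16 / (1 + \<sigma>\<^sup>2)"
proof (cases "\<bar>\<sigma>\<bar> \<le> 1")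
  case True
  have "cmod (FT1 bump \<sigma>) \<le> (LINT t|lborel. \<bar>bump t\<bar>)"
    by (rule cmod_FT1_le)
  also have "\<dots> \<le> (LINT t|lborel. indicator {-1..1::real} t)"
  proof (rule integral_mono)
    show "\<bar>bump t\<bar> \<le> indicator {-1..1} t" for t
      using bump_bounds [of t] by (auto simp: bump_def indicator_def)
  qed (use bump_integrable in auto)
  also have "\<dots> = 2" by simp
  finally have "cmod (FT1 bump \<sigma>) \<le> 2" .
  moreover have "2 * (1 + \<sigma>\<^sup>2) \<le> 16"
    using True abs_square_le_1[of \<sigma>] by simp
  ultimately have "cmod (FT1 bump \<sigma>) * (1 + \<sigma>\<^sup>2) \<le> 16"
    by (meson add_nonneg_nonneg mult_right_mono order_trans zero_le_one zero_le_power2)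
  then show ?thesis
    by (simp add: pos_le_divide_eq add_pos_nonneg)
next
  case False
  then have s: "\<sigma> \<noteq> 0" "1 \<le> \<bar>\<sigma>\<bar>" "1 \<le> \<sigma>\<^sup>2"
    using one_le_power[of "\<bar>\<sigma>\<bar>" 2] by auto
  have 3: "2 / \<bar>\<sigma>\<bar>^3 \<le> 2 / \<sigma>\<^sup>2"
    using s power_increasing[of 2 3 "\<bar>\<sigma>\<bar>"] by (intro divide_left_mono) auto
  have "cmod (- 2 / \<sigma>\<^sup>2 + 2 * \<i> / \<sigma>^3) \<le> 2 / \<sigma>\<^sup>2 + 2 / \<bar>\<sigma>\<bar>^3"
    by (rule norm_triangle_le) (simp add: norm_divide norm_mult norm_power)
  moreover have "cmod (2 / \<sigma>\<^sup>2 + 2 * \<i> / \<sigma>^3) \<le> 2 / \<sigma>\<^sup>2 + 2 / \<bar>\<sigma>\<bar>^3"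
    by (rule norm_triangle_le) (simp add: norm_divide norm_mult norm_power)
  moreover have "cmod (FT1 bump \<sigma>) \<le> cmod (- 2 / \<sigma>\<^sup>2 + 2 * \<i> / \<sigma>^3) + cmod (2 / \<sigma>\<^sup>2 + 2 * \<i> / \<sigma>^3)"
    unfolding FT1_bump_eq [OF s(1)] by (rule order_trans [OF norm_triangle_ineq4]) (simp add: norm_mult)
  ultimately have "cmod (FT1 bump \<sigma>) \<le> 8 / \<sigma>\<^sup>2"
    using 3 by simp
  also have "\<dots> = 16 / (\<sigma>\<^sup>2 + \<sigma>\<^sup>2)" by simp
  also have "\<dots> \<le> 16 / (1 + \<sigma>\<^sup>2)"
    using s by (intro divide_left_mono) (auto intro!: add_pos_nonneg mult_pos_pos)
  finally show ?thesis .
qed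

text \<open>This is the integral over \<sigma> in the squared input norm. The crude bound 1 +
  |\<sigma>| \<le> 2 (1 + \<sigma>^2) leaves one power of 1/(1 + \<sigma>^2), with constant 512 = 2
  * 16^2.\<close>

lemma FT1_bump_weighted_integrable:
  "integrable lborel (\<lambda>\<sigma>. (1 + \<bar>\<sigma>\<bar>) * (cmod (FT1 bump \<sigma>))\<^sup>2)"
proof (rule Bochner_Integration.integrable_bound)
  show "integrable lborel (\<lambda>\<sigma>::real. 512 * inverse (1 + \<sigma>\<^sup>2))"
    using integrable_inverse_1_plus_square by (simp add: set_integrable_def)
  show "AE \<sigma> in lborel. norm ((1 + \<bar>\<sigma>\<bar>) * (cmod (FT1 bump \<sigma>))\<^sup>2) \<le> norm (512 * inverse (1 + \<sigma>\<^sup>2))"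
  proof (rule AE_I2)
    fix \<sigma> :: real
    have p: "1 + \<sigma>\<^sup>2 > 0" by (simp add: add_pos_nonneg)
    have scale: "(2 * z) * (16 / z)\<^sup>2 = 512 * inverse z" if "z > 0" for z :: real
      using that by (simp add: field_simps power2_eq_square)
    have "(cmod (FT1 bump \<sigma>))\<^sup>2 \<le> (16 / (1 + \<sigma>\<^sup>2))\<^sup>2"
      by (intro power_mono cmod_FT1_bump_le) auto
    moreover have "1 + \<bar>\<sigma>\<bar> \<le> 2 * (1 + \<sigma>\<^sup>2)"
      using zero_le_power2[of "\<bar>\<sigma>\<bar> - 1"] unfolding power2_diff by simp (smt (verit) zero_le_power2)
    ultimately have "(1 + \<bar>\<sigma>\<bar>) * (cmod (FT1 bump \<sigma>))\<^sup>2 \<le> (2 * (1 + \<sigma>\<^sup>2)) * (16 / (1 + \<sigma>\<^sup>2))\<^sup>2"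
      by (intro mult_mono) auto
    also have "\<dots> = 512 * inverse (1 + \<sigma>\<^sup>2)"
      using scale [of "1 + \<sigma>\<^sup>2"] p by simp
    finally show "norm ((1 + \<bar>\<sigma>\<bar>) * (cmod (FT1 bump \<sigma>))\<^sup>2) \<le> norm (512 * inverse (1 + \<sigma>\<^sup>2))"
      using p by simp
  qed
qed measurable

lemma cos_ge_half:
  fixes y :: real
  assumes "\<bar>y\<bar> \<le> 1"
  shows "1/2 \<le> cos y"
proof -
  have "cos (pi/3) \<le> cos \<bar>y\<bar>"
    using assms pi_gt3 by (intro cos_monotone_0_pi_le) auto
  then show ?thesis by (simp add: cos_60)
qed

text \<open>There is no cancellation: |t \<sigma>| \<le> 1 on the support, so the real part of the
  integrand is nonnegative. For |t| \<le> 1/2 it is at least 1/2 * (3/4)^2 > 1/4, on an interval of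
  length 1.\<close>

lemma cmod_FT1_bump_square_ge:
  assumes "\<bar>\<sigma>\<bar> \<le> 1"
  shows "1/4 \<le> cmod (FT1 (\<lambda>t. bump t * bump t) \<sigma>)"
proof -
  let ?e = "\<lambda>t. exp (- \<i> * complex_of_real (t * \<sigma>)) * complex_of_real (bump t * bump t)"
  have int: "integrable lborel ?e"
    by (rule Bochner_Integration.integrable_bound [OF bump_square_integrable])
      (auto simp: norm_mult simp del: of_real_mult)
  have re: "Re (?e t) = cos (t * \<sigma>) * (bump t)\<^sup>2" for t
    unfolding Re_complex_of_real by (simp add: Re_exp power2_eq_square del: of_real_mult)
  have "(1/4 :: real) = (LINT t|lborel. 1/4 * indicator {-1/2..1/2::real} t)"
    by simp
  also have "\<dots> \<le> (LINT t|lborel. Re (?e t))"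
  proof (intro integral_mono integrable_Re int)
    fix t :: real
    show "1/4 * indicator {-1/2..1/2} t \<le> Re (?e t)"
    proof (cases "\<bar>t\<bar> \<le> 1")
      case True
      have "\<bar>t * \<sigma>\<bar> \<le> 1"
        using True assms by (simp add: abs_mult mult_le_one)
      then have c: "1/2 \<le> cos (t * \<sigma>)" by (rule cos_ge_half)
      show ?thesis
      proof (cases "\<bar>t\<bar> \<le> 1/2")
        case True
        then have "t\<^sup>2 \<le> (1/2)\<^sup>2"
          using power_mono[of "\<bar>t\<bar>" "1/2" 2] by simp
        then have "3/4 \<le> bump t"
          using True \<open>\<bar>t\<bar> \<le> 1\<close> by (auto simp: bump_def power2_eq_square indicator_def abs_le_iff)
        then have "(3/4)\<^sup>2 \<le> (bump t)\<^sup>2"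
          by (intro power_mono) auto
        then have "1/2 * (3/4)\<^sup>2 \<le> cos (t * \<sigma>) * (bump t)\<^sup>2"
          using c by (intro mult_mono) auto
        then show ?thesis
          unfolding re using True by (simp add: indicator_def power2_eq_square)
      next
        case False
        then have "indicator {-1/2..1/2} t = (0 :: real)"
          by (auto simp: indicator_def abs_le_iff)
        moreover have "0 \<le> cos (t * \<sigma>) * (bump t)\<^sup>2"
          using c by simp
        ultimately show ?thesis
          unfolding re by simp
      qed
    qed (auto simp: re indicator_def bump_def)
  qed simp
  also have "\<dots> = Re (FT1 (\<lambda>t. bump t * bump t) \<sigma>)"
    unfolding FT1_def by (rule integral_Re [OF int])
  also have "\<dots> \<le> cmod (FT1 (\<lambda>t. bump t * bump t) \<sigma>)"
    by (rule complex_Re_le_cmod)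
  finally show ?thesis .
qed

section \<open>The profile in space: the Gaussian and its transform\<close>

definition gauss :: "real \<Rightarrow> real" where
  "gauss x = exp (- x\<^sup>2 / 2)"

lemma gauss_eq_density: "gauss x = sqrt (2 * pi) * std_normal_density x"
  by (simp add: gauss_def std_normal_density_def)

lemma gauss_nonneg: "0 \<le> gauss x"
  by (simp add: gauss_def)

lemma gauss_square: "gauss x * gauss x = gauss (sqrt 2 * x)"
  by (simp add: gauss_def exp_add [symmetric] power_mult_distrib)

lemma gauss_measurable [measurable]: "gauss \<in> borel_measurable borel"
  unfolding gauss_def [abs_def] by measurable

lemma gauss_integrable: "integrable lborel gauss"
  unfolding gauss_eq_density [abs_def] using integrable_std_normal_moment [of 0] by simp

lemma gauss_square_integrable: "integrable lborel (\<lambda>x. gauss x * gauss x)"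
  unfolding gauss_square using lborel_integrable_real_affine [OF gauss_integrable, of "sqrt 2" 0] by simp

text \<open>Up to sqrt (2 pi) this is the characteristic function of the standard normal
  distribution, taken at -y because \<open>char\<close> has the kernel exp (i t x).\<close>

lemma FT1_gauss: "FT1 gauss y = sqrt (2 * pi) * exp (- y\<^sup>2 / 2)"
proof -
  have "char std_normal_distribution (- y)
      = (LINT x|lborel. std_normal_density x *\<^sub>R exp (\<i> * complex_of_real (- y * x)))"
    unfolding char_def by (subst integral_density) auto
  also have "\<dots> = (LINT x|lborel. exp (- \<i> * complex_of_real (x * y)) * complex_of_real (std_normal_density x))"
    by (simp add: scaleR_conv_of_real mult_ac)
  finally have "FT1 std_normal_density y = exp (- y\<^sup>2 / 2)"
    by (simp add: FT1_def char_std_normal_distribution)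
  moreover have "FT1 gauss y = (LINT x|lborel. complex_of_real (sqrt (2 * pi)) *
      (exp (- \<i> * complex_of_real (x * y)) * complex_of_real (std_normal_density x)))"
    unfolding FT1_def gauss_eq_density by (simp add: mult_ac)
  ultimately show ?thesis
    unfolding integral_mult_right_zero FT1_def [symmetric] by simp
qed

lemma FT1_gauss_square: "FT1 (\<lambda>x. gauss x * gauss x) y = sqrt pi * exp (- y\<^sup>2 / 4)"
proof -
  have "FT1 (\<lambda>x. gauss x * gauss x) y = 1 / sqrt 2 * FT1 gauss (y / sqrt 2)"
    unfolding gauss_square FT1_def [of "\<lambda>x. gauss (sqrt 2 * x)"]
    using FT1_affine [of "sqrt 2" y gauss 0] by simp
  then show ?thesis
    by (simp add: FT1_gauss real_sqrt_mult power_divide)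
qed

text \<open>Follows from (1 + x/m)^m \<le> exp x with x = c q, after dropping the 1.\<close>

lemma power_le_exp:
  fixes q :: real
  assumes "0 \<le> q" "0 < c"
  shows "q ^ m \<le> (m / c) ^ m * exp (c * q)"
proof (cases "m = 0")
  case False
  have "(1 + (c * q) / m) ^ m \<le> exp (c * q)"
    using assms False by (intro exp_ge_one_plus_x_over_n_power_n) (auto intro: order_trans [of _ 0])
  moreover have "(c * q / m) ^ m \<le> (1 + (c * q) / m) ^ m"
    using assms by (intro power_mono) auto
  ultimately have "(m / c) ^ m * (c * q / m) ^ m \<le> (m / c) ^ m * exp (c * q)"
    using assms by (intro mult_left_mono) auto
  then show ?thesis
    using False assms by (simp add: power_mult_distrib [symmetric])
qed (use assms in auto)

lemma FT1_gauss_weighted_integrable: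
  "integrable lborel (\<lambda>\<eta>. (4 + 4 * \<eta>\<^sup>2) powr p * (cmod (FT1 gauss \<eta>))\<^sup>2)"
proof (rule Bochner_Integration.integrable_bound)
  define m where "m = nat \<lceil>p\<rceil>"
  \<comment> \<open>With c = 1/8 in \<open>power_le_exp\<close> the weight costs exp (1/2 +
    \<eta>^2/2), half of the decay exp (-\<eta>^2) of the squared transform. The other half is
    \<open>gauss\<close> again.\<close>
  let ?K = "2 * pi * ((m / (1/8)) ^ m * exp (1/2))"
  show "integrable lborel (\<lambda>\<eta>. ?K * gauss \<eta>)"
    using gauss_integrable by simp
  show "AE \<eta> in lborel. norm ((4 + 4 * \<eta>\<^sup>2) powr p * (cmod (FT1 gauss \<eta>))\<^sup>2) \<le> norm (?K * gauss \<eta>)"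
  proof (rule AE_I2)
    fix \<eta> :: real
    have "(4 + 4 * \<eta>\<^sup>2) powr p \<le> (4 + 4 * \<eta>\<^sup>2) powr real m"
      by (intro powr_mono) (auto simp: m_def real_nat_ceiling_ge)
    also have "\<dots> = (4 + 4 * \<eta>\<^sup>2) ^ m"
      by (intro powr_realpow) (auto intro: add_pos_nonneg)
    also have "\<dots> \<le> (m / (1/8)) ^ m * exp (1/8 * (4 + 4 * \<eta>\<^sup>2))"
      by (intro power_le_exp) auto
    finally have "(4 + 4 * \<eta>\<^sup>2) powr p \<le> (m / (1/8)) ^ m * exp (1/8 * (4 + 4 * \<eta>\<^sup>2))" .
    moreover have "(cmod (FT1 gauss \<eta>))\<^sup>2 = 2 * pi * exp (- \<eta>\<^sup>2)"
      by (simp add: FT1_gauss norm_mult power_mult_distrib exp_double [symmetric])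
    ultimately have "(4 + 4 * \<eta>\<^sup>2) powr p * (cmod (FT1 gauss \<eta>))\<^sup>2
        \<le> (m / (1/8)) ^ m * exp (1/8 * (4 + 4 * \<eta>\<^sup>2)) * (2 * pi * exp (- \<eta>\<^sup>2))"
      by (simp add: mult_right_mono)
    also have "\<dots> = 2 * pi * (m / (1/8)) ^ m * (exp (1/8 * (4 + 4 * \<eta>\<^sup>2)) * exp (- \<eta>\<^sup>2))"
      by simp
    also have "exp (1/8 * (4 + 4 * \<eta>\<^sup>2)) * exp (- \<eta>\<^sup>2) = exp (1/2) * gauss \<eta>"
      by (simp add: gauss_def exp_add [symmetric] field_simps)
    finally show "norm ((4 + 4 * \<eta>\<^sup>2) powr p * (cmod (FT1 gauss \<eta>))\<^sup>2) \<le> norm (?K * gauss \<eta>)"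
      by (simp add: abs_mult gauss_nonneg mult_ac)
  qed
qed measurable

section \<open>Weighted norms of the packets\<close>

lemma jbr_ge_1: "1 \<le> jbr z"
  by (simp add: jbr_def)

lemma jbr_ge_cmod: "cmod z \<le> jbr z"
  by (simp add: jbr_def real_le_rsqrt)

lemma jbr_le: "jbr z \<le> 1 + cmod z"
proof -
  have "1 + (cmod z)\<^sup>2 \<le> (1 + cmod z)\<^sup>2"
    by (simp add: power2_sum)
  then show ?thesis
    unfolding jbr_def by (rule real_le_lsqrt [rotated]) simp
qed

lemma jbr_measurable [measurable]: "jbr \<in> borel_measurable borel"
  unfolding jbr_def [abs_def] by measurable

lemma Xweight_measurable [measurable]: "Xweight \<alpha> b s \<in> borel_measurable borel"
proof -
  have "Xweight \<alpha> b s \<in> borel_measurable (borel \<Otimes>\<^sub>M borel)"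
    unfolding Xweight_def by measurable
  then show ?thesis by (simp add: borel_prod)
qed

lemma FT_packet_measurable:
  assumes "integrable lborel a" "integrable lborel g" "L > 0" "\<gamma> > 0"
  shows "FT (packet L \<gamma> \<omega> k c a g) \<in> borel_measurable borel"
proof -
  have [measurable]: "a \<in> borel_measurable borel" "g \<in> borel_measurable borel"
    using assms by auto
  have "FT (packet L \<gamma> \<omega> k c a g)
      = (\<lambda>(\<tau>, \<xi>). FT1 a ((\<tau> - \<omega> - c * (\<xi> - k)) / L) * FT1 g ((\<xi> - k) / \<gamma>) / (L * \<gamma>))"
    using FT_packet [OF assms] by auto
  also have "\<dots> \<in> borel_measurable (borel \<Otimes>\<^sub>M borel)"
    by measurable
  finally show ?thesis by (simp add: borel_prod)
qed

lemma Xnorm_hat_le: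
  assumes "(\<integral>\<^sup>+ p. ennreal ((Xweight \<alpha> b s p * cmod (f p))\<^sup>2) \<partial>lborel) \<le> ennreal B" and "0 \<le> B"
  shows "Xnorm_hat \<alpha> b s f \<le> ennreal (sqrt B)"
proof -
  let ?I = "\<integral>\<^sup>+ p. ennreal ((Xweight \<alpha> b s p * cmod (f p))\<^sup>2) \<partial>lborel"
  have "?I \<noteq> \<infinity>"
    using assms(1) by (auto simp: top_unique)
  moreover have "enn2real ?I \<le> B"
    using assms by (rule enn2real_leI [rotated])
  ultimately show ?thesis
    by (simp add: Xnorm_hat_def ennreal_leI)
qed

lemma Xnorm_hat_ge:
  assumes "ennreal B \<le> (\<integral>\<^sup>+ p. ennreal ((Xweight \<alpha> b s p * cmod (f p))\<^sup>2) \<partial>lborel)"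
  shows "ennreal (sqrt B) \<le> Xnorm_hat \<alpha> b s f"
proof -
  let ?I = "\<integral>\<^sup>+ p. ennreal ((Xweight \<alpha> b s p * cmod (f p))\<^sup>2) \<partial>lborel"
  show ?thesis
  proof (cases "?I = \<infinity>")
    case False
    then have "B \<le> enn2real ?I"
      using assms by (cases ?I) (auto simp: ennreal_le_iff2)
    then show ?thesis
      using False by (simp add: Xnorm_hat_def ennreal_leI)
  qed (simp add: Xnorm_hat_def)
qed

text \<open>What remains of the squared input norm once the powers of N, L and \<gamma> are taken
  out; the majorant separates in \<sigma> and \<eta>. In the exponent, 2 comes from the modulation
  and -2s from the frequency weight.\<close>

definition packet_const :: "real \<Rightarrow> real" where
  "packet_const s = (LINT \<sigma>|lborel. (1 + \<bar>\<sigma>\<bar>) * (cmod (FT1 bump \<sigma>))\<^sup>2)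
    * (LINT \<eta>|lborel. (4 + 4 * \<eta>\<^sup>2) powr (2 - 2 * s) * (cmod (FT1 gauss \<eta>))\<^sup>2)"

lemma packet_const_nonneg: "0 \<le> packet_const s"
  unfolding packet_const_def by (intro mult_nonneg_nonneg integral_nonneg_AE) auto

text \<open>\<gamma> is the largest width for which the curvature N \<gamma>^2 stays within L. The
  bound \<alpha> \<le> a puts the dissipation within L; 1/2 \<le> a gives \<gamma> \<ge> 1; a \<le>
  1 gives \<gamma>^2 \<le> N, so that only |\<eta>| of order at least sqrt N can bring the frequency
  near 0.\<close>

locale scales =
  fixes \<alpha> a N \<gamma> L :: real
  assumes \<alpha>: "0 < \<alpha>" "\<alpha> \<le> 1" and a: "\<alpha> \<le> a" "1/2 \<le> a" "a \<le> 1" and N: "1 \<le> N"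
    and \<gamma>_def: "\<gamma> = N powr (a - 1/2)" and L_def: "L = N powr (2 * a)"
begin

lemma \<gamma>_ge_1: "1 \<le> \<gamma>"
  unfolding \<gamma>_def using N a by (simp add: ge_one_powr_ge_zero)

lemma L_ge_1: "1 \<le> L"
  unfolding L_def using N a by (simp add: ge_one_powr_ge_zero)

lemma N_mult_\<gamma>_square: "N * \<gamma>\<^sup>2 = L"
proof -
  have "N * \<gamma>\<^sup>2 = N powr 1 * (N powr (a - 1/2) * N powr (a - 1/2))"
    using N by (simp add: \<gamma>_def power2_eq_square)
  also have "\<dots> = L"
    unfolding powr_add [symmetric] L_def by simp
  finally show ?thesis .
qed

lemma \<gamma>_square_le: "\<gamma>\<^sup>2 \<le> N"
proof -
  have "\<gamma>\<^sup>2 = N powr (2 * a - 1)"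
    by (simp add: \<gamma>_def power2_eq_square powr_add [symmetric])
  also have "\<dots> \<le> N powr 1"
    using N a by (intro powr_mono) auto
  finally show ?thesis using N by simp
qed

lemma \<gamma>_le: "\<gamma> \<le> N"
  using \<gamma>_ge_1 \<gamma>_square_le self_le_power [of \<gamma> 2] by simp

lemma \<gamma>_cube_le: "\<gamma>^3 \<le> L"
proof -
  have "\<gamma>^3 = \<gamma> * \<gamma>\<^sup>2"
    by (simp add: power3_eq_cube power2_eq_square)
  also have "\<dots> \<le> N * \<gamma>\<^sup>2"
    by (intro mult_right_mono \<gamma>_le) simp
  finally show ?thesis by (simp add: N_mult_\<gamma>_square)
qed

lemma abs_frequency_le:
  assumes "\<bar>n\<bar> = N"
  shows "\<bar>n + \<gamma> * \<eta>\<bar> \<le> N * (1 + \<bar>\<eta>\<bar>)"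
proof -
  have "\<gamma> * \<bar>\<eta>\<bar> \<le> N * \<bar>\<eta>\<bar>"
    by (intro mult_right_mono \<gamma>_le) simp
  moreover have "\<bar>n + \<gamma> * \<eta>\<bar> \<le> \<bar>n\<bar> + \<gamma> * \<bar>\<eta>\<bar>"
    using \<gamma>_ge_1 abs_triangle_ineq [of n "\<gamma> * \<eta>"] by (simp add: abs_mult)
  ultimately show ?thesis using assms by (simp add: distrib_left)
qed

text \<open>The factors of N (1 + |\<eta>|) get different exponents: N is raised to 2a, which is
  exactly L, and 1 + |\<eta>| to 2, since the Gaussian pays for any power of \<eta>.\<close>

lemma dissipation_le:
  assumes "\<bar>n\<bar> = N"
  shows "\<bar>n + \<gamma> * \<eta>\<bar> powr (2 * \<alpha>) \<le> L * (1 + \<bar>\<eta>\<bar>)\<^sup>2"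
proof -
  have "\<bar>n + \<gamma> * \<eta>\<bar> powr (2 * \<alpha>) \<le> (N * (1 + \<bar>\<eta>\<bar>)) powr (2 * \<alpha>)"
    using \<alpha> abs_frequency_le [OF assms] by (intro powr_mono2) auto
  also have "\<dots> = N powr (2 * \<alpha>) * (1 + \<bar>\<eta>\<bar>) powr (2 * \<alpha>)"
    using N by (simp add: powr_mult)
  also have "\<dots> \<le> N powr (2 * a) * (1 + \<bar>\<eta>\<bar>) powr 2"
    using N \<alpha> a by (intro mult_mono powr_mono) auto
  also have "\<dots> = L * (1 + \<bar>\<eta>\<bar>)\<^sup>2"
    by (simp add: L_def powr_realpow [of "1 + \<bar>\<eta>\<bar>" 2, simplified])
  finally show ?thesis .
qed

text \<open>Expanding the cube at n cancels n^3 and the tangent term 3 n^2 \<gamma> \<eta>. What is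
  left is L \<sigma>, the curvature 3 n \<gamma>^2 \<eta>^2 with N \<gamma>^2 = L, and \<gamma>^3
  \<eta>^3 with \<gamma>^3 \<le> L.\<close>

lemma jbr_modulation_le:
  assumes "\<bar>n\<bar> = N"
  shows "jbr (\<i> * complex_of_real ((n^3 + 3 * n\<^sup>2 * (\<gamma> * \<eta>) + L * \<sigma>) - (n + \<gamma> * \<eta>)^3)
      + complex_of_real (\<bar>n + \<gamma> * \<eta>\<bar> powr (2 * \<alpha>)))
    \<le> L * (1 + \<bar>\<sigma>\<bar>) * (4 + 4 * \<eta>\<^sup>2)\<^sup>2" (is "jbr (\<i> * complex_of_real ?m + complex_of_real ?d) \<le> _")
proof -
  have "?m = L * \<sigma> - 3 * n * \<gamma>\<^sup>2 * \<eta>\<^sup>2 - \<gamma>^3 * \<eta>^3"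
    by (simp add: algebra_simps power2_eq_square power3_eq_cube)
  then have "\<bar>?m\<bar> \<le> \<bar>L * \<sigma>\<bar> + \<bar>3 * n * \<gamma>\<^sup>2 * \<eta>\<^sup>2\<bar> + \<bar>\<gamma>^3 * \<eta>^3\<bar>"
    by linarith
  also have "\<dots> = L * \<bar>\<sigma>\<bar> + 3 * (N * \<gamma>\<^sup>2) * \<eta>\<^sup>2 + \<gamma>^3 * \<bar>\<eta>\<bar>^3"
    using assms L_ge_1 \<gamma>_ge_1 by (simp add: abs_mult power_abs)
  also have "\<dots> \<le> L * \<bar>\<sigma>\<bar> + 3 * L * \<eta>\<^sup>2 + L * \<bar>\<eta>\<bar>^3"
    unfolding N_mult_\<gamma>_square using \<gamma>_cube_le by (intro add_left_mono mult_right_mono) auto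
  finally have m: "\<bar>?m\<bar> \<le> L * (\<bar>\<sigma>\<bar> + 3 * \<eta>\<^sup>2 + \<bar>\<eta>\<bar>^3)"
    by (simp add: algebra_simps)
  have "jbr (\<i> * complex_of_real ?m + complex_of_real ?d) \<le> 1 + (\<bar>?m\<bar> + \<bar>?d\<bar>)"
    by (rule order_trans [OF jbr_le add_left_mono], rule norm_triangle_le)
      (simp add: norm_mult del: of_real_add of_real_mult of_real_diff of_real_power)
  also have "\<dots> \<le> L + (L * (\<bar>\<sigma>\<bar> + 3 * \<eta>\<^sup>2 + \<bar>\<eta>\<bar>^3) + L * (1 + \<bar>\<eta>\<bar>)\<^sup>2)"
    using L_ge_1 m dissipation_le [OF assms, of \<eta>] by (intro add_mono) auto
  also have "\<dots> = L * (1 + \<bar>\<sigma>\<bar> + 3 * \<eta>\<^sup>2 + \<bar>\<eta>\<bar>^3 + (1 + \<bar>\<eta>\<bar>)\<^sup>2)"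
    by (simp add: algebra_simps)
  also have "\<dots> \<le> L * ((1 + \<bar>\<sigma>\<bar>) * (4 + 4 * \<eta>\<^sup>2)\<^sup>2)"
  proof (intro mult_left_mono)
    \<comment> \<open>The bound is far from sharp; its base 4 + 4 \<eta>^2 is the one of
      \<open>jbr_frequency_ge\<close>, so both losses merge into a single power.\<close>
    have poly: "1 + 3 * y\<^sup>2 + y^3 + (1 + y)\<^sup>2 \<le> (4 + 4 * y\<^sup>2)\<^sup>2" if "0 \<le> y" for y :: real
    proof -
      have "y^3 \<le> y\<^sup>2 + y^4"
      proof -
        have "0 \<le> y\<^sup>2 * ((y - 1)\<^sup>2 + y)"
          using that by simp
        also have "\<dots> = y\<^sup>2 + y^4 - y^3"
          by (simp add: algebra_simps power2_eq_square power3_eq_cube power4_eq_xxxx)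
        finally show ?thesis by simp
      qed
      moreover have "2 * y \<le> 1 + y\<^sup>2"
        using zero_le_power2 [of "y - 1"] by (simp add: power2_diff)
      moreover have "(4 + 4 * y\<^sup>2)\<^sup>2 = 16 + 32 * y\<^sup>2 + 16 * y^4"
        by (simp add: algebra_simps power2_eq_square power4_eq_xxxx)
      moreover have "0 \<le> y^4" "0 \<le> y\<^sup>2"
        by simp_all
      moreover have "(1 + y)\<^sup>2 = 1 + 2 * y + y\<^sup>2"
        by (simp add: power2_sum)
      ultimately show ?thesis
        by linarith
    qed
    have "1 \<le> (4 + 4 * \<eta>\<^sup>2)\<^sup>2"
      by (rule one_le_power) simp
    then have "\<bar>\<sigma>\<bar> * 1 \<le> \<bar>\<sigma>\<bar> * (4 + 4 * \<eta>\<^sup>2)\<^sup>2"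
      by (intro mult_left_mono) auto
    with poly [of "\<bar>\<eta>\<bar>"]
    show "1 + \<bar>\<sigma>\<bar> + 3 * \<eta>\<^sup>2 + \<bar>\<eta>\<bar>^3 + (1 + \<bar>\<eta>\<bar>)\<^sup>2 \<le> (1 + \<bar>\<sigma>\<bar>) * (4 + 4 * \<eta>\<^sup>2)\<^sup>2"
      by (simp add: distrib_right)
  qed (use L_ge_1 in simp)
  finally show ?thesis by (simp add: mult.assoc)
qed

text \<open>Since s \<le> 0, bounding the weight from above needs the frequency from below. The
  Gaussian tail reaches frequency 0, so the bound has to weaken as \<eta> grows.\<close>

lemma jbr_frequency_ge:
  assumes "\<bar>n\<bar> = N"
  shows "N / (4 + 4 * \<eta>\<^sup>2) \<le> jbr (complex_of_real (n + \<gamma> * \<eta>))"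
proof (cases "\<gamma> * \<bar>\<eta>\<bar> \<le> N / 2")
  case True
  have "N / (4 + 4 * \<eta>\<^sup>2) \<le> N / 2"
    using N by (intro divide_left_mono) (auto intro: add_pos_nonneg)
  also have "\<dots> \<le> \<bar>n + \<gamma> * \<eta>\<bar>"
    using True assms \<gamma>_ge_1 abs_triangle_ineq2 [of n "- (\<gamma> * \<eta>)"] by (simp add: abs_mult)
  also have "\<dots> \<le> jbr (complex_of_real (n + \<gamma> * \<eta>))"
    using jbr_ge_cmod [of "complex_of_real (n + \<gamma> * \<eta>)"] by (simp del: of_real_add of_real_mult)
  finally show ?thesis .
next
  \<comment> \<open>\<open>\<gamma>\<^sup>2 \<le> N\<close> forces \<open>4\<eta>\<^sup>2 \<ge> N\<close> here, so the trivial bound \<open>jbr \<ge> 1\<close> suffices.\<close>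
  case False
  then have "(N / 2)\<^sup>2 \<le> (\<gamma> * \<bar>\<eta>\<bar>)\<^sup>2"
    using N by (intro power_mono) auto
  also have "\<dots> \<le> N * \<eta>\<^sup>2"
    using \<gamma>_square_le by (simp add: power_mult_distrib mult_right_mono)
  finally have "N * N \<le> N * (4 * \<eta>\<^sup>2)"
    by (simp add: power2_eq_square)
  then have "N \<le> 4 * \<eta>\<^sup>2"
    using N by simp
  then have "N / (4 + 4 * \<eta>\<^sup>2) \<le> 1"
    using N by simp
  then show ?thesis
    using jbr_ge_1 order_trans by blast
qed

lemma Xweight_square_le:
  assumes "\<bar>n\<bar> = N" and "s \<le> 0"
  shows "(Xweight \<alpha> (1/2) s (n^3 + 3 * n\<^sup>2 * (\<gamma> * \<eta>) + L * \<sigma>, n + \<gamma> * \<eta>))\<^sup>2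
    \<le> L * N powr (2 * s) * (1 + \<bar>\<sigma>\<bar>) * (4 + 4 * \<eta>\<^sup>2) powr (2 - 2 * s)"
proof -
  let ?Z = "\<i> * complex_of_real ((n^3 + 3 * n\<^sup>2 * (\<gamma> * \<eta>) + L * \<sigma>) - (n + \<gamma> * \<eta>)^3)
      + complex_of_real (\<bar>n + \<gamma> * \<eta>\<bar> powr (2 * \<alpha>))"
  let ?q = "4 + 4 * \<eta>\<^sup>2"
  have q: "0 < ?q"
    by (simp add: add_pos_nonneg)
  have Z: "0 < jbr ?Z"
    using jbr_ge_1 [of ?Z] by linarith
  have "(Xweight \<alpha> (1/2) s (n^3 + 3 * n\<^sup>2 * (\<gamma> * \<eta>) + L * \<sigma>, n + \<gamma> * \<eta>))\<^sup>2
      = (jbr ?Z powr (1/2))\<^sup>2 * (jbr (complex_of_real (n + \<gamma> * \<eta>)) powr s)\<^sup>2"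
    unfolding Xweight_def prod.case power_mult_distrib ..
  also have "\<dots> = jbr ?Z * jbr (complex_of_real (n + \<gamma> * \<eta>)) powr (2 * s)"
    using Z by (simp add: power2_eq_square powr_add [symmetric] del: of_real_add of_real_mult of_real_diff of_real_power)
  also have "\<dots> \<le> (L * (1 + \<bar>\<sigma>\<bar>) * ?q\<^sup>2) * (N / ?q) powr (2 * s)"
  proof (intro mult_mono jbr_modulation_le [OF assms(1)])
    show "jbr (complex_of_real (n + \<gamma> * \<eta>)) powr (2 * s) \<le> (N / ?q) powr (2 * s)"
      using assms(2) N q jbr_frequency_ge [OF assms(1)] by (intro powr_mono2') auto
  qed (use L_ge_1 in auto)
  also have "\<dots> = L * (1 + \<bar>\<sigma>\<bar>) * N powr (2 * s) * (?q powr 2 * ?q powr (- 2 * s))"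
  proof -
    have "(N / ?q) powr (2 * s) = N powr (2 * s) * ?q powr (- 2 * s)"
      using N powr_divide [of N ?q "2 * s"] by (simp add: powr_minus divide_inverse)
    then show ?thesis
      using q by simp
  qed
  also have "\<dots> = L * N powr (2 * s) * (1 + \<bar>\<sigma>\<bar>) * ?q powr (2 - 2 * s)"
    unfolding powr_add [symmetric] by simp
  finally show ?thesis .
qed

text \<open>Power count for the square: L N^(2s) from the weight, (L \<gamma>)^(-2) from the
  transform and L \<gamma> from the Jacobian. All powers of L cancel.\<close>

lemma Xnorm_packet_le:
  assumes n: "\<bar>n\<bar> = N" and "s \<le> 0"
  shows "Xnorm \<alpha> (1/2) s (packet L \<gamma> (n^3) n (3 * n\<^sup>2) bump gauss)
    \<le> ennreal (sqrt (packet_const s * N powr (2 * s) / \<gamma>))"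
  unfolding Xnorm_def
proof (rule Xnorm_hat_le)
  let ?u = "packet L \<gamma> (n^3) n (3 * n\<^sup>2) bump gauss"
  let ?A = "\<lambda>\<sigma>. (1 + \<bar>\<sigma>\<bar>) * (cmod (FT1 bump \<sigma>))\<^sup>2"
  let ?B = "\<lambda>\<eta>. (4 + 4 * \<eta>\<^sup>2) powr (2 - 2 * s) * (cmod (FT1 gauss \<eta>))\<^sup>2"
  let ?k = "N powr (2 * s) / (L * \<gamma>\<^sup>2)"
  have pos: "0 < L" "0 < \<gamma>"
    using L_ge_1 \<gamma>_ge_1 by auto
  note [measurable] = FT_packet_measurable [OF bump_integrable gauss_integrable pos]
  have le: "(Xweight \<alpha> (1/2) s p * cmod (FT ?u p))\<^sup>2 \<le> ?k * ?A \<sigma> * ?B \<eta>"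
    if "p = (n^3 + 3 * n\<^sup>2 * (\<gamma> * \<eta>) + L * \<sigma>, n + \<gamma> * \<eta>)" for p \<sigma> \<eta>
  proof -
    have "cmod (FT ?u p) = cmod (FT1 bump \<sigma>) * cmod (FT1 gauss \<eta>) / (L * \<gamma>)"
      unfolding that FT_packet [OF bump_integrable gauss_integrable pos]
      using pos by (simp add: norm_mult norm_divide)
    then have "(Xweight \<alpha> (1/2) s p * cmod (FT ?u p))\<^sup>2
        = (Xweight \<alpha> (1/2) s p)\<^sup>2 * ((cmod (FT1 bump \<sigma>))\<^sup>2 * (cmod (FT1 gauss \<eta>))\<^sup>2 / (L * \<gamma>)\<^sup>2)"
      by (simp add: power_mult_distrib power_divide)
    also have "\<dots> \<le> (L * N powr (2 * s) * (1 + \<bar>\<sigma>\<bar>) * (4 + 4 * \<eta>\<^sup>2) powr (2 - 2 * s))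
        * ((cmod (FT1 bump \<sigma>))\<^sup>2 * (cmod (FT1 gauss \<eta>))\<^sup>2 / (L * \<gamma>)\<^sup>2)"
      unfolding that by (intro mult_right_mono Xweight_square_le assms) auto
    also have "\<dots> = ?k * ?A \<sigma> * ?B \<eta>"
      using pos by (simp add: field_simps power2_eq_square)
    finally show ?thesis .
  qed
  have "(\<integral>\<^sup>+ p. ennreal ((Xweight \<alpha> (1/2) s p * cmod (FT ?u p))\<^sup>2) \<partial>lborel)
      = ennreal (L * \<gamma>) * (\<integral>\<^sup>+\<eta>. \<integral>\<^sup>+\<sigma>. ennreal ((Xweight \<alpha> (1/2) s
          (n^3 + 3 * n\<^sup>2 * (\<gamma> * \<eta>) + L * \<sigma>, n + \<gamma> * \<eta>)
        * cmod (FT ?u (n^3 + 3 * n\<^sup>2 * (\<gamma> * \<eta>) + L * \<sigma>, n + \<gamma> * \<eta>)))\<^sup>2) \<partial>lborel \<partial>lborel)"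
    using pos by (intro nn_integral_lborel_packet_coords) auto
  also have "\<dots> \<le> ennreal (L * \<gamma>) * (\<integral>\<^sup>+\<eta>. \<integral>\<^sup>+\<sigma>. ennreal (?k * ?A \<sigma> * ?B \<eta>) \<partial>lborel \<partial>lborel)"
    by (intro mult_left_mono nn_integral_mono ennreal_leI le) auto
  also have "(\<lambda>\<eta>. \<integral>\<^sup>+\<sigma>. ennreal (?k * ?A \<sigma> * ?B \<eta>) \<partial>lborel)
      = (\<lambda>\<eta>. ennreal (integral\<^sup>L lborel ?A * ?k * ?B \<eta>))"
  proof
    fix \<eta>
    have "(\<integral>\<^sup>+\<sigma>. ennreal (?k * ?A \<sigma> * ?B \<eta>) \<partial>lborel) = ennreal (LINT \<sigma>|lborel. ?k * ?A \<sigma> * ?B \<eta>)"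
      using pos FT1_bump_weighted_integrable by (intro nn_integral_eq_integral) auto
    also have "(LINT \<sigma>|lborel. ?k * ?A \<sigma> * ?B \<eta>) = integral\<^sup>L lborel ?A * ?k * ?B \<eta>"
      by simp
    finally show "(\<integral>\<^sup>+\<sigma>. ennreal (?k * ?A \<sigma> * ?B \<eta>) \<partial>lborel) = ennreal (integral\<^sup>L lborel ?A * ?k * ?B \<eta>)" .
  qed
  also have "(\<integral>\<^sup>+\<eta>. ennreal (integral\<^sup>L lborel ?A * ?k * ?B \<eta>) \<partial>lborel)
      = ennreal (LINT \<eta>|lborel. integral\<^sup>L lborel ?A * ?k * ?B \<eta>)"
    using pos FT1_gauss_weighted_integrable
    by (intro nn_integral_eq_integral integrable_mult_right)
      (auto intro!: mult_nonneg_nonneg integral_nonneg_AE)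
  also have "(LINT \<eta>|lborel. integral\<^sup>L lborel ?A * ?k * ?B \<eta>) = packet_const s * ?k"
    by (simp add: packet_const_def)
  also have "ennreal (L * \<gamma>) * ennreal (packet_const s * ?k) = ennreal (L * \<gamma> * (packet_const s * ?k))"
    using pos by (intro ennreal_mult [symmetric]) (simp_all add: packet_const_nonneg)
  also have "L * \<gamma> * (packet_const s * ?k) = packet_const s * N powr (2 * s) / \<gamma>"
    using pos by (simp add: field_simps power2_eq_square)
  finally show "(\<integral>\<^sup>+ p. ennreal ((Xweight \<alpha> (1/2) s p * cmod (FT ?u p))\<^sup>2) \<partial>lborel)
      \<le> ennreal (packet_const s * N powr (2 * s) / \<gamma>)" .
qed (use \<gamma>_ge_1 in \<open>auto intro!: mult_nonneg_nonneg divide_nonneg_nonneg packet_const_nonneg\<close>)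

section \<open>The product at low frequency: lower bound for the output norm\<close>

lemma jbr_modulation_low_le:
  assumes \<sigma>: "\<bar>\<sigma>\<bar> \<le> 1" and \<eta>: "1 \<le> \<eta>" "\<eta> \<le> 2"
  shows "jbr (\<i> * complex_of_real ((3 * N\<^sup>2 * (\<gamma> * \<eta>) + L * \<sigma>) - (\<gamma> * \<eta>)^3)
      + complex_of_real (\<bar>\<gamma> * \<eta>\<bar> powr (2 * \<alpha>))) \<le> 20 * (N\<^sup>2 * \<gamma>)"
    (is "jbr (\<i> * complex_of_real ?m + complex_of_real ?d) \<le> _")
proof -
  have g: "1 \<le> \<gamma>" "0 < \<gamma>" and N': "1 \<le> N\<^sup>2" "0 < N"
    using \<gamma>_ge_1 N by auto
  have 1: "1 \<le> N\<^sup>2 * \<gamma>"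
    using mult_mono [of 1 "N\<^sup>2" 1 \<gamma>] g N' by simp
  have \<gamma>2: "\<gamma>\<^sup>2 \<le> N * \<gamma>"
    using mult_right_mono [OF \<gamma>_le, of \<gamma>] g by (simp add: power2_eq_square)
  have "\<gamma>^3 = \<gamma>\<^sup>2 * \<gamma>"
    by (simp add: power2_eq_square power3_eq_cube)
  also have "\<dots> \<le> N\<^sup>2 * \<gamma>"
    using g \<gamma>_le by (intro mult_right_mono power_mono) auto
  finally have 3: "\<gamma>^3 \<le> N\<^sup>2 * \<gamma>" .
  have "L \<le> N * (N * \<gamma>)"
    unfolding N_mult_\<gamma>_square [symmetric] using \<gamma>2 N by (intro mult_left_mono) auto
  then have L: "L \<le> N\<^sup>2 * \<gamma>"
    by (simp add: power2_eq_square mult.assoc)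
  have "1 * \<gamma>\<^sup>2 \<le> N * (N * \<gamma>)"
    using \<gamma>2 N by (intro mult_mono) auto
  then have 2: "\<gamma>\<^sup>2 \<le> N\<^sup>2 * \<gamma>"
    by (simp add: power2_eq_square mult.assoc)
  have "\<bar>L * \<sigma>\<bar> \<le> L"
    using L_ge_1 \<sigma> by (simp add: abs_mult mult_left_le)
  moreover have "\<bar>3 * N\<^sup>2 * (\<gamma> * \<eta>)\<bar> \<le> 6 * (N\<^sup>2 * \<gamma>)"
    using g \<eta> mult_left_mono [of \<eta> 2 "N\<^sup>2 * \<gamma>"] by (simp add: abs_mult mult_ac)
  moreover have "\<bar>(\<gamma> * \<eta>)^3\<bar> \<le> 8 * \<gamma>^3"
  proof -
    have "(\<gamma> * \<eta>)^3 \<le> (\<gamma> * 2)^3"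
      using g \<eta> by (intro power_mono mult_left_mono) auto
    then show ?thesis
      using g \<eta> by (simp add: power_mult_distrib)
  qed
  moreover have "\<bar>?m\<bar> \<le> \<bar>3 * N\<^sup>2 * (\<gamma> * \<eta>)\<bar> + \<bar>L * \<sigma>\<bar> + \<bar>(\<gamma> * \<eta>)^3\<bar>"
    by linarith
  ultimately have m: "\<bar>?m\<bar> \<le> 15 * (N\<^sup>2 * \<gamma>)"
    using L 3 by linarith
  have "1 * 1 \<le> \<gamma> * \<eta>"
    using g \<eta> by (intro mult_mono) auto
  then have "?d \<le> (\<gamma> * \<eta>) powr 2"
    using \<alpha> powr_mono [of "2 * \<alpha>" 2 "\<gamma> * \<eta>"] by simp
  also have "\<dots> = \<gamma>\<^sup>2 * \<eta>\<^sup>2"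
    using g \<eta> by (simp add: powr_numeral power_mult_distrib)
  also have "\<dots> \<le> \<gamma>\<^sup>2 * 2\<^sup>2"
    using \<eta> by (intro mult_left_mono power_mono) auto
  finally have d: "?d \<le> 4 * (N\<^sup>2 * \<gamma>)"
    using 2 by simp
  \<comment> \<open>20 = 1 + 15 + 4, where 15 = 6 + 1 + 8 collects the distance term 3 N^2 \<gamma>
    \<eta>, the term L \<sigma> and the cube, and 4 bounds the dissipation.\<close>
  have "jbr (\<i> * complex_of_real ?m + complex_of_real ?d) \<le> 1 + (\<bar>?m\<bar> + \<bar>?d\<bar>)"
    by (rule order_trans [OF jbr_le add_left_mono], rule norm_triangle_le)
      (simp add: norm_mult del: of_real_add of_real_mult of_real_diff of_real_power)
  also have "\<dots> \<le> 20 * (N\<^sup>2 * \<gamma>)"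
    using 1 m d by simp
  finally show ?thesis .
qed

text \<open>Upper bounds on the brackets give lower bounds on powers with nonpositive exponents. As
  b may be positive, it is lowered to \<beta> \<le> 0, which is possible because the bracket is at
  least 1.\<close>

lemma Xweight_low_square_ge:
  assumes \<sigma>: "\<bar>\<sigma>\<bar> \<le> 1" and \<eta>: "1 \<le> \<eta>" "\<eta> \<le> 2" and "s \<le> 0" "\<beta> \<le> 0" "\<beta> \<le> b"
  shows "(20 * (N\<^sup>2 * \<gamma>)) powr (2 * \<beta>) * (3 * \<gamma>) powr (2 * s)
    \<le> (Xweight \<alpha> b s (3 * N\<^sup>2 * (\<gamma> * \<eta>) + L * \<sigma>, \<gamma> * \<eta>))\<^sup>2"
proof -
  let ?Z = "\<i> * complex_of_real ((3 * N\<^sup>2 * (\<gamma> * \<eta>) + L * \<sigma>) - (\<gamma> * \<eta>)^3)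
      + complex_of_real (\<bar>\<gamma> * \<eta>\<bar> powr (2 * \<alpha>))"
  let ?X = "complex_of_real (\<gamma> * \<eta>)"
  have Z: "1 \<le> jbr ?Z" and X: "1 \<le> jbr ?X"
    by (rule jbr_ge_1)+
  have "jbr ?X \<le> 1 + \<bar>\<gamma> * \<eta>\<bar>"
    using jbr_le [of ?X] by (simp del: of_real_mult)
  also have "\<dots> \<le> 3 * \<gamma>"
  proof -
    have "0 \<le> \<gamma> * \<eta>" "\<gamma> * \<eta> \<le> \<gamma> * 2"
      using \<gamma>_ge_1 \<eta> by auto
    then show ?thesis
      using \<gamma>_ge_1 by linarith
  qed
  finally have X_le: "jbr ?X \<le> 3 * \<gamma>" .
  have "(20 * (N\<^sup>2 * \<gamma>)) powr (2 * \<beta>) * (3 * \<gamma>) powr (2 * s) \<le> jbr ?Z powr (2 * \<beta>) * jbr ?X powr (2 * s)"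
    using Z X X_le jbr_modulation_low_le [OF \<sigma> \<eta>] assms(4,5)
    by (intro mult_mono powr_mono2') auto
  also have "\<dots> \<le> jbr ?Z powr (2 * b) * jbr ?X powr (2 * s)"
    using Z assms(6) by (intro mult_right_mono powr_mono) auto
  also have "\<dots> = (Xweight \<alpha> b s (3 * N\<^sup>2 * (\<gamma> * \<eta>) + L * \<sigma>, \<gamma> * \<eta>))\<^sup>2"
    unfolding Xweight_def prod.case power_mult_distrib
    by (simp only: power2_eq_square powr_add [symmetric] mult_2)
  finally show ?thesis .
qed

text \<open>Only the rectangle |\<sigma>| \<le> 1, 1 \<le> \<eta> \<le> 2 is kept; there the factor
  |\<xi>| = \<gamma> \<eta> of the derivative is at least \<gamma>. Besides the weight, the square
  receives \<gamma>^2 from the derivative, (L \<gamma>)^(-2) from the transform and L \<gamma> from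
  the Jacobian, that is \<gamma>/L.\<close>

lemma Xnorm_dx_packet_ge:
  assumes "s \<le> 0" "\<beta> \<le> 0" "\<beta> \<le> b"
  shows "ennreal (sqrt (20 powr (2 * \<beta>) * 3 powr (2 * s) / 256
      * (N powr (4 * \<beta>) * \<gamma> powr (2 * \<beta> + 2 * s + 1) / L)))
    \<le> Xnorm_dx \<alpha> b s (packet L \<gamma> 0 0 (3 * N\<^sup>2) (\<lambda>t. bump t * bump t) (\<lambda>x. gauss x * gauss x))"
  unfolding Xnorm_dx_def
proof (rule Xnorm_hat_ge)
  let ?w = "packet L \<gamma> 0 0 (3 * N\<^sup>2) (\<lambda>t. bump t * bump t) (\<lambda>x. gauss x * gauss x)"
  let ?dw = "\<lambda>(\<tau>, \<xi>). \<i> * complex_of_real \<xi> * FT ?w (\<tau>, \<xi>)"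
  let ?F = "\<lambda>p. ennreal ((Xweight \<alpha> b s p * cmod (?dw p))\<^sup>2)"
  have pos: "0 < L" "0 < \<gamma>"
    using L_ge_1 \<gamma>_ge_1 by auto
  note [measurable] = FT_packet_measurable [OF bump_square_integrable gauss_square_integrable pos]
  have F [measurable]: "?F \<in> borel_measurable borel"
  proof -
    have [measurable]: "FT ?w \<in> borel_measurable (borel \<Otimes>\<^sub>M borel)"
      "Xweight \<alpha> b s \<in> borel_measurable (borel \<Otimes>\<^sub>M borel)"
      by (simp_all add: borel_prod)
    have "?F \<in> borel_measurable (borel \<Otimes>\<^sub>M borel)"
      by measurable
    then show ?thesis by (simp add: borel_prod)
  qed
  \<comment> \<open>1/16 is 1/4 from the time profile times 1/4 from the Gaussian; its square is the
    1/256 of the statement.\<close>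
  define m where "m = (20 * (N\<^sup>2 * \<gamma>)) powr (2 * \<beta>) * (3 * \<gamma>) powr (2 * s) * (\<gamma> * (1/16) / (L * \<gamma>))\<^sup>2"
  have m: "m \<le> (Xweight \<alpha> b s p * cmod (?dw p))\<^sup>2"
    if p: "p = (3 * N\<^sup>2 * (\<gamma> * \<eta>) + L * \<sigma>, \<gamma> * \<eta>)" and \<sigma>: "\<bar>\<sigma>\<bar> \<le> 1" and \<eta>: "1 \<le> \<eta>" "\<eta> \<le> 2" for p \<sigma> \<eta>
  proof -
    have "exp (-1) \<le> exp (- \<eta>\<^sup>2 / 4)"
      using \<eta> power_mono [of \<eta> 2 2] by simp
    moreover have "1/4 \<le> exp (-1 :: real)"
      using exp_le by (simp add: exp_minus field_simps)
    ultimately have "1/4 \<le> exp (- \<eta>\<^sup>2 / 4)"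
      by linarith
    moreover have "1 \<le> sqrt pi"
      using pi_gt3 by simp
    ultimately have "1 * (1/4) \<le> sqrt pi * exp (- \<eta>\<^sup>2 / 4)"
      by (intro mult_mono) auto
    also have "\<dots> = cmod (FT1 (\<lambda>x. gauss x * gauss x) \<eta>)"
      by (simp add: FT1_gauss_square norm_mult)
    finally have "1/4 * (1/4) \<le> cmod (FT1 (\<lambda>t. bump t * bump t) \<sigma>) * cmod (FT1 (\<lambda>x. gauss x * gauss x) \<eta>)"
      by (intro mult_mono cmod_FT1_bump_square_ge \<sigma>) auto
    then have "\<gamma> * (1/16) / (L * \<gamma>) \<le> (\<gamma> * \<eta>)
        * (cmod (FT1 (\<lambda>t. bump t * bump t) \<sigma>) * cmod (FT1 (\<lambda>x. gauss x * gauss x) \<eta>)) / (L * \<gamma>)"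
      using pos \<eta> by (intro divide_right_mono mult_mono) auto
    also have "\<dots> = cmod (?dw p)"
      unfolding p prod.case FT_packet [OF bump_square_integrable gauss_square_integrable pos]
      using pos \<eta> by (simp add: norm_mult norm_divide)
    finally have "(\<gamma> * (1/16) / (L * \<gamma>))\<^sup>2 \<le> (cmod (?dw p))\<^sup>2"
      using pos by (intro power_mono) auto
    then show ?thesis
      unfolding m_def power_mult_distrib p
      by (intro mult_mono Xweight_low_square_ge \<sigma> \<eta> assms) auto
  qed
  have "20 powr (2 * \<beta>) * 3 powr (2 * s) / 256 * (N powr (4 * \<beta>) * \<gamma> powr (2 * \<beta> + 2 * s + 1) / L)
      = L * \<gamma> * m"
  proof -
    have "(20 * (N\<^sup>2 * \<gamma>)) powr (2 * \<beta>) = 20 powr (2 * \<beta>) * (N powr (4 * \<beta>) * \<gamma> powr (2 * \<beta>))"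
      using pos N by (simp add: powr_mult powr_powr flip: powr_numeral)
    moreover have "(3 * \<gamma>) powr (2 * s) = 3 powr (2 * s) * \<gamma> powr (2 * s)"
      using pos by (simp add: powr_mult)
    moreover have "\<gamma> powr (2 * \<beta> + 2 * s + 1) = \<gamma> powr (2 * \<beta>) * \<gamma> powr (2 * s) * \<gamma>"
      using pos by (simp add: powr_add)
    ultimately show ?thesis
      unfolding m_def using pos by (simp add: field_simps power2_eq_square)
  qed
  \<comment> \<open>The factor 1 stands for the area of the rectangle, which is 2.\<close>
  also have "ennreal (L * \<gamma> * m) = ennreal (L * \<gamma>) * (ennreal m * 1)"
    using pos by (simp add: ennreal_mult m_def)
  also have "\<dots> \<le> ennreal (L * \<gamma>) * (ennreal m * (\<integral>\<^sup>+\<eta>. indicator {1..2::real} \<eta> * (\<integral>\<^sup>+\<sigma>. indicator {-1..1::real} \<sigma> \<partial>lborel) \<partial>lborel))"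
    by (intro mult_left_mono) (simp_all add: nn_integral_multc)
  also have "\<dots> = ennreal (L * \<gamma>) * (\<integral>\<^sup>+\<eta>. \<integral>\<^sup>+\<sigma>. ennreal m * (indicator {1..2::real} \<eta> * indicator {-1..1::real} \<sigma>) \<partial>lborel \<partial>lborel)"
    by (simp add: nn_integral_cmult nn_integral_multc)
  also have "\<dots> \<le> ennreal (L * \<gamma>) * (\<integral>\<^sup>+\<eta>. \<integral>\<^sup>+\<sigma>. ?F (0 + 3 * N\<^sup>2 * (\<gamma> * \<eta>) + L * \<sigma>, 0 + \<gamma> * \<eta>) \<partial>lborel \<partial>lborel)"
  proof (intro mult_left_mono nn_integral_mono)
    fix \<eta> \<sigma> :: real
    show "ennreal m * (indicator {1..2} \<eta> * indicator {-1..1} \<sigma>)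
        \<le> ?F (0 + 3 * N\<^sup>2 * (\<gamma> * \<eta>) + L * \<sigma>, 0 + \<gamma> * \<eta>)"
    proof (cases "\<eta> \<in> {1..2} \<and> \<sigma> \<in> {-1..1}")
      case True
      then show ?thesis
        using m [OF refl, of \<sigma> \<eta>] by (simp add: ennreal_leI abs_le_iff)
    qed auto
  qed simp
  also have "\<dots> = (\<integral>\<^sup>+p. ?F p \<partial>lborel)"
    by (rule nn_integral_lborel_packet_coords [OF F pos, symmetric])
  finally show "ennreal (20 powr (2 * \<beta>) * 3 powr (2 * s) / 256
      * (N powr (4 * \<beta>) * \<gamma> powr (2 * \<beta> + 2 * s + 1) / L)) \<le> (\<integral>\<^sup>+p. ?F p \<partial>lborel)" .
qed

end

section \<open>Failure of the bilinear estimate\<close>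

theorem theorem1p2:
  fixes \<alpha> s \<nu> \<delta> T C :: real
  assumes "0 < \<alpha>" and "\<alpha> \<le> 1" and "s \<le> s_alpha \<alpha>"
    and "\<nu> > 0" and "\<delta> > 0" and "T > 0" and "C > 0"
  shows "\<exists>u v :: real \<times> real \<Rightarrow> complex.
     admissible u \<and> admissible v \<and>
     (\<forall>t x. \<bar>t\<bar> > T \<longrightarrow> u (t, x) = 0 \<and> v (t, x) = 0) \<and>
     Xnorm \<alpha> (1/2) s u < \<infinity> \<and> Xnorm \<alpha> (1/2) s v < \<infinity> \<and>
     Xnorm_dx \<alpha> (-1/2 + \<delta>) s (\<lambda>p. u p * v p)
       > ennreal (C * T powr \<nu>) * Xnorm \<alpha> (1/2) s u * Xnorm \<alpha> (1/2) s v"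
proof -
  \<comment> \<open>For \<alpha> \<le> 1/2 this gives \<gamma> = 1 and L = N.\<close>
  define a where "a = max \<alpha> (1/2)"
  have a: "\<alpha> \<le> a" "1/2 \<le> a" "a \<le> 1"
    using assms(2) by (auto simp: a_def)
  \<comment> \<open>Both branches of \<open>s_alpha\<close> equal -3/(5 - 2a): for \<alpha> \<le>
    1/2 the denominator is 4.\<close>
  have s_a: "s * (5 - 2 * a) \<le> - 3"
  proof (cases "\<alpha> \<le> 1/2")
    case True
    then show ?thesis
      using assms(3) by (simp add: a_def s_alpha_def)
  next
    case False
    then show ?thesis
      using assms(2,3) pos_le_divide_eq [of "5 - 2 * \<alpha>" s "- 3"] by (simp add: a_def s_alpha_def)
  qed
  have s: "s \<le> 0"
  proof (rule ccontr)
    assume "\<not> s \<le> 0"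
    then have "0 \<le> s * (5 - 2 * a)"
      using a by simp
    then show False using s_a by simp
  qed
  \<comment> \<open>The cap 1/2 ensures \<beta> \<le> 0, as the lower bound for the output
    requires.\<close>
  define \<epsilon> where "\<epsilon> = min \<delta> (1/2)"
  define \<beta> where "\<beta> = - 1/2 + \<epsilon>"
  have \<epsilon>: "0 < \<epsilon>" and \<beta>: "\<beta> \<le> 0" "\<beta> \<le> - 1/2 + \<delta>"
    using assms(5) by (auto simp: \<epsilon>_def \<beta>_def)
  \<comment> \<open>The exponent 4\<beta> + (a - 1/2)(2\<beta> + 2s + 1) - 2a of N in the squared
    output bound, minus the exponent 2 (2s - (a - 1/2)) of the squared product of the input
    bounds.\<close>
  define e where "e = - 3 - s * (5 - 2 * a) + \<epsilon> * (2 * a + 3)"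
  have "0 < \<epsilon> * (2 * a + 3)"
    using \<epsilon> a by (intro mult_pos_pos) auto
  then have "0 < e"
    using s_a unfolding e_def by linarith
  define \<kappa> where "\<kappa> = 20 powr (2 * \<beta>) * 3 powr (2 * s) / (256 :: real)"
  have \<kappa>: "0 < \<kappa>" by (simp add: \<kappa>_def)
  define K where "K = C * T powr \<nu> * packet_const s"
  \<comment> \<open>The summand 1 makes M positive and turns M \<le> N^e into a strict inequality
    for K^2/\<kappa>.\<close>
  define M where "M = K\<^sup>2 / \<kappa> + 1"
  have M: "0 < M"
    using \<kappa> by (simp add: M_def add_nonneg_pos)
  \<comment> \<open>Three demands: N \<ge> 1 for the locale, N \<ge> 1/T so that the support |t|
    \<le> 1/L lies in [-T, T] (as N \<le> L), and N^e \<ge> M to beat the constants, which are fixed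
    before N.\<close>
  define N where "N = max 1 (max (1 / T) (M powr (1 / e)))"
  have "M = (M powr (1 / e)) powr e"
    using M \<open>0 < e\<close> by (simp add: powr_powr)
  also have "\<dots> \<le> N powr e"
    using \<open>0 < e\<close> by (intro powr_mono2) (auto simp: N_def)
  finally have N_large: "1 \<le> N" "1 / T \<le> N" "K\<^sup>2 / \<kappa> < N powr e"
    by (auto simp: N_def M_def)
  define \<gamma> where "\<gamma> = N powr (a - 1/2)"
  define L where "L = N powr (2 * a)"
  interpret scales \<alpha> a N \<gamma> L
    using assms a N_large by unfold_locales (auto simp: \<gamma>_def L_def)
  have pos: "0 < L" "0 < \<gamma>" "0 < N"
    using L_ge_1 \<gamma>_ge_1 N by auto
  have "N powr 1 \<le> L"
    unfolding L_def using N a by (intro powr_mono) auto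
  then have "N \<le> L"
    using N by simp
  then have "1 / T \<le> L"
    using N_large(2) by linarith
  then have LT: "1 \<le> L * T"
    using assms(6) by (simp add: pos_divide_le_eq)
  let ?u = "\<lambda>n. packet L \<gamma> (n^3) n (3 * n\<^sup>2) bump gauss"
  have adm: "admissible (?u n)" for n
    using pos bump_integrable gauss_integrable bump_square_integrable gauss_square_integrable
    by (intro packet_admissible) (auto simp: power2_eq_square)
  have supp: "?u n (t, x) = 0" if "T < \<bar>t\<bar>" for n t x
  proof -
    have "L * T < L * \<bar>t\<bar>"
      using that pos by simp
    also have "\<dots> = \<bar>L * t\<bar>"
      using pos by (simp add: abs_mult)
    finally have "1 < \<bar>L * t\<bar>"
      using LT by linarith
    then show ?thesis
      by (auto simp: packet_def bump_def indicator_def abs_le_iff)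
  qed
  let ?B = "packet_const s * N powr (2 * s) / \<gamma>"
  have B: "0 \<le> ?B"
    using pos by (simp add: packet_const_nonneg)
  have norm_u: "Xnorm \<alpha> (1/2) s (?u n) \<le> ennreal (sqrt ?B)" if "\<bar>n\<bar> = N" for n
    using that s by (rule Xnorm_packet_le)
  have fin: "Xnorm \<alpha> (1/2) s (?u n) < \<infinity>" if "\<bar>n\<bar> = N" for n
    using norm_u [OF that] by (rule le_less_trans) simp
  \<comment> \<open>The carriers are opposite because cubes are odd, while 3 n^2 is even in n, so
    they cancel and the velocity is kept.\<close>
  have uv: "(\<lambda>p. ?u N p * ?u (- N) p)
      = packet L \<gamma> 0 0 (3 * N\<^sup>2) (\<lambda>t. bump t * bump t) (\<lambda>x. gauss x * gauss x)"
    using packet_mult [of L \<gamma> "N^3" N "3 * N\<^sup>2" bump gauss _ "- (N^3)" "- N" bump gauss] by simp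
  let ?R = "\<kappa> * (N powr (4 * \<beta>) * \<gamma> powr (2 * \<beta> + 2 * s + 1) / L)"
  have "ennreal (C * T powr \<nu>) * Xnorm \<alpha> (1/2) s (?u N) * Xnorm \<alpha> (1/2) s (?u (- N))
      \<le> ennreal (C * T powr \<nu>) * ennreal (sqrt ?B) * ennreal (sqrt ?B)"
    using norm_u [of N] norm_u [of "- N"] pos by (intro mult_mono) auto
  also have "\<dots> = ennreal (C * T powr \<nu> * (sqrt ?B * sqrt ?B))"
    using B assms(7) by (simp only: ennreal_mult [symmetric] mult.assoc real_sqrt_ge_zero
      mult_nonneg_nonneg powr_ge_zero less_imp_le)
  also have "C * T powr \<nu> * (sqrt ?B * sqrt ?B) = K * (N powr (2 * s) / \<gamma>)"
    unfolding real_sqrt_mult_self abs_of_nonneg [OF B] K_def by simp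
  also have "\<dots> < ennreal (sqrt ?R)"
  proof (rule ennreal_lessI [OF _ real_less_rsqrt])
    have "\<gamma> powr (2 * \<beta> + 2 * s + 1) = N powr ((a - 1/2) * (2 * \<beta> + 2 * s + 1))"
      by (simp add: \<gamma>_def powr_powr)
    then have R: "?R = \<kappa> * N powr (4 * \<beta> + (a - 1/2) * (2 * \<beta> + 2 * s + 1) - 2 * a)"
      by (simp add: L_def powr_add powr_diff)
    have "(N powr (2 * s) / \<gamma>)\<^sup>2 = N powr (2 * (2 * s - (a - 1/2)))"
      unfolding \<gamma>_def powr_diff [symmetric] by (simp only: power2_eq_square powr_add [symmetric] mult_2)
    then have "(K * (N powr (2 * s) / \<gamma>))\<^sup>2 = K\<^sup>2 * N powr (2 * (2 * s - (a - 1/2)))"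
      by (simp only: power_mult_distrib)
    also have "\<dots> < \<kappa> * N powr e * N powr (2 * (2 * s - (a - 1/2)))"
      using N_large(3) \<kappa> pos by (intro mult_strict_right_mono) (auto simp: pos_divide_less_eq mult.commute)
    also have "\<dots> = \<kappa> * N powr (e + 2 * (2 * s - (a - 1/2)))"
      by (simp only: powr_add mult.assoc)
    also have "e + 2 * (2 * s - (a - 1/2)) = 4 * \<beta> + (a - 1/2) * (2 * \<beta> + 2 * s + 1) - 2 * a"
      by (simp add: e_def \<beta>_def algebra_simps)
    finally show "(K * (N powr (2 * s) / \<gamma>))\<^sup>2 < ?R"
      unfolding R .
    then show "0 < sqrt ?R"
      by (smt (verit) real_sqrt_gt_zero zero_le_power2)
  qed
  also have "\<dots> \<le> Xnorm_dx \<alpha> (-1/2 + \<delta>) s (\<lambda>p. ?u N p * ?u (- N) p)"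
    unfolding uv \<kappa>_def by (rule Xnorm_dx_packet_ge [OF s \<beta>])
  finally have "ennreal (C * T powr \<nu>) * Xnorm \<alpha> (1/2) s (?u N) * Xnorm \<alpha> (1/2) s (?u (- N))
      < Xnorm_dx \<alpha> (-1/2 + \<delta>) s (\<lambda>p. ?u N p * ?u (- N) p)" .
  moreover have "Xnorm \<alpha> (1/2) s (?u N) < \<infinity>" "Xnorm \<alpha> (1/2) s (?u (- N)) < \<infinity>"
    using pos by (intro fin; simp)+
  ultimately show ?thesis
    using adm supp by blast
qed

end
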